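(* If $\Phi$ is the canonical twisting on the partition monoid $\mathcal P_n$ with $n\geq2$, then $$\bigl\langle E(\mathbb N\times_\Phi^1\mathcal P_n)\bigr\rangle=\{(0,1)\}\cup\bigl(\mathbb N\times\operatorname{Sing}(\mathcal P_n)\bigr).$$
   Context: Write $\mathbf n=\{1,\dots,n\}$, $\mathbf n'=\{1',\dots,n'\}$, $\mathbf n''=\{1'',\dots,n''\}$ (disjoint copies). $\mathcal P_n$ is the set of all set partitions of $\mathbf n\cup\mathbf n'$. A partition is identified with any graph on $\mathbf n\cup\mathbf n'$ whose connected components are its blocks. For $a,b\in\mathcal P_n$, let $a^\vee$ be $a$ with each $x'$ renamed $x''$ and $b^\wedge$ be $b$ with each $x$ renamed $x''$; the product graph $\Pi(a,b)$ on $\mathbf n\cup\mathbf n''\cup\mathbf n'$ has as edges the union of the edges of $a^\vee$ and $b^\wedge$. The product $ab\in\mathcal P_n$ is the partition in which $x,y\in\mathbf n\cup\mathbf n'$ are in the same block iff they are in the same connected component of $\Pi(a,b)$. The identity $1$ of $\mathcal P_n$ has blocks $\{x,x'\}$, $x\in\mathbf n$. The canonical twisting is $\Phi(a,b)$ = the number of floating components of $\Pi(a,b)$, i.e. connected components contained in $\mathbf n''$. $\mathcal S_n\subseteq\mathcal P_n$ is the group of units (partitions all of whose blocks have the form $\{x,y'\}$), and $\operatorname{Sing}(\mathcal P_n)=\mathcal P_n\setminus\mathcal S_n$. $\mathbb N=\{0,1,2,\dots\}$. $\mathbb N\times_\Phi^1\mathcal P_n$ is the monoid with underlying set $\mathbb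 N\times\mathcal P_n$ and product $(i,a)(j,b)=(i+j+\Phi(a,b),ab)$, with identity $(0,1)$. $E(X)$ is the set of idempotents of $X$, and $\langle E(X)\rangle$ the submonoid generated by it. *)

theory Defs
  imports "HOL.Hull" "HOL-Algebra.Group" "HOL-Library.Disjoint_Sets"
begin

text \<open>
  \<open>Up x\<close>, \<open>Low x\<close>, \<open>Mid x\<close> stand for \<open>x\<close>, \<open>x'\<close>, \<open>x''\<close>.  Partitions live on the
  upper and lower vertices; the middle ones occur only in product graphs.
\<close>

datatype vertex = Up nat | Mid nat | Low nat

type_synonym diagram = "vertex set set"

definition outer_vertices :: "nat \<Rightarrow> vertex set" where
  "outer_vertices n = Up ` {1..n} \<union> Low ` {1..n}"

definition middle_vertices :: "nat \<Rightarrow> vertex set" where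
  "middle_vertices n = Mid ` {1..n}"

definition partitions :: "nat \<Rightarrow> diagram set" where
  "partitions n = {a. partition_on (outer_vertices n) a}"

text \<open>
  Among the graphs whose connected components are the blocks of \<open>a\<close> we fix the one that joins
  any two vertices of the same block.  It contains all loops and is symmetric, so reachability
  in a union of such graphs is an equivalence relation on their vertices.
\<close>

definition block_edges :: "diagram \<Rightarrow> (vertex \<times> vertex) set" where
  "block_edges a = (\<Union>B\<in>a. B \<times> B)"

fun low_to_mid :: "vertex \<Rightarrow> vertex" where
  "low_to_mid (Low x) = Mid x"
| "low_to_mid (Up x) = Up x"
| "low_to_mid (Mid x) = Mid x"

fun up_to_mid :: "vertex \<Rightarrow> vertex" where
  "up_to_mid (Up x) = Mid x"
| "up_to_mid (Low x) = Low x"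
| "up_to_mid (Mid x) = Mid x"

definition rename :: "(vertex \<Rightarrow> vertex) \<Rightarrow> diagram \<Rightarrow> diagram" where
  "rename f a = (\<lambda>B. f ` B) ` a"

definition product_graph :: "diagram \<Rightarrow> diagram \<Rightarrow> (vertex \<times> vertex) set" where
  "product_graph a b = block_edges (rename low_to_mid a) \<union> block_edges (rename up_to_mid b)"

definition components :: "vertex set \<Rightarrow> (vertex \<times> vertex) set \<Rightarrow> vertex set set" where
  "components V E = V // E\<^sup>*"

definition diagram_product :: "nat \<Rightarrow> diagram \<Rightarrow> diagram \<Rightarrow> diagram" where
  "diagram_product n a b =
     outer_vertices n //
       {(x, y) \<in> outer_vertices n \<times> outer_vertices n. (x, y) \<in> (product_graph a b)\<^sup>*}"

definition partition_monoid :: "nat \<Rightarrow> diagram monoid" where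
  "partition_monoid n =
     \<lparr>carrier = partitions n,
      mult = diagram_product n,
      one = (\<lambda>x. {Up x, Low x}) ` {1..n}\<rparr>"

definition canonical_twisting :: "nat \<Rightarrow> diagram \<Rightarrow> diagram \<Rightarrow> nat" where
  "canonical_twisting n a b =
     card {C \<in> components (outer_vertices n \<union> middle_vertices n) (product_graph a b).
             C \<subseteq> middle_vertices n}"

definition singular_partitions :: "nat \<Rightarrow> diagram set" where
  "singular_partitions n = carrier (partition_monoid n) - Units (partition_monoid n)"

definition twisted_product :: "('a \<Rightarrow> 'a \<Rightarrow> nat) \<Rightarrow> ('a, 'm) monoid_scheme \<Rightarrow> (nat \<times> 'a) monoid"
  where
  "twisted_product \<Phi> M =
     \<lparr>carrier = UNIV \<times> carrier M,
      mult = (\<lambda>(i, a) (j, b). (i + j + \<Phi> a b, a \<otimes>\<^bsub>M\<^esub> b)),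
      one = (0, \<one>\<^bsub>M\<^esub>)\<rparr>"

abbreviation twisted_partition_monoid :: "nat \<Rightarrow> (nat \<times> diagram) monoid" where
  "twisted_partition_monoid n \<equiv> twisted_product (canonical_twisting n) (partition_monoid n)"

definition idempotents :: "('a, 'm) monoid_scheme \<Rightarrow> 'a set" where
  "idempotents M = {x \<in> carrier M. x \<otimes>\<^bsub>M\<^esub> x = x}"

text \<open>The library's \<open>generate\<close> also closes under inverses, so it is not the notion wanted here.\<close>

definition generated_submonoid :: "('a, 'm) monoid_scheme \<Rightarrow> 'a set \<Rightarrow> 'a set" where
  "generated_submonoid M X = (\<lambda>H. submonoid H M) hull X"

end

theory Submission
  imports Defs
begin

text \<open>
  A partition is described by a pair of labellings \<open>u\<close>, \<open>v\<close> of its upper and lower vertices, so that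
  its transversal blocks correspond to the labels common to both.  If the labellings have fewer than
  \<open>n\<close> labels in common, then inserting a suitable middle labelling \<open>g\<close> factorises \<open>(u, v)\<close> into
  \<open>(u, g)\<close> and \<open>(g, v)\<close>, and the floating components are the labels that occur only in \<open>g\<close>.
  In this way one first reduces the twist to zero, then the partition to one all of whose
  blocks are transversal, that is, to a pair of surjections onto a set of fewer than \<open>n\<close> labels;
  such a pair is made equal by changing one value at a time, each change being
  multiplication by an idempotent.  Conversely, the singular partitions form an ideal, and the
  only idempotent unit is the identity.
\<close>

section \<open>Partitions as equivalence relations, and edges of product graphs\<close>

lemma block_edges_quotient:
  assumes "equiv A r"
  shows "block_edges (A // r) = r"
proof
  show "block_edges (A // r) \<subseteq> r"
    using quotient_eq_iff[OF assms] by (auto simp: block_edges_def)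
  show "r \<subseteq> block_edges (A // r)"
  proof clarify
    fix x y assume "(x, y) \<in> r"
    moreover from this have "x \<in> A"
      using equiv_type[OF assms] by blast
    ultimately show "(x, y) \<in> block_edges (A // r)"
      using equiv_class_self[OF assms] quotientI[of x A r] unfolding block_edges_def by blast
  qed
qed

lemma quotient_block_edges:
  assumes "partition_on A P"
  shows "equiv A (block_edges P)" and "A // block_edges P = P"
proof -
  have eq: "block_edges P = {(x, y). \<exists>B\<in>P. x \<in> B \<and> y \<in> B}"
    by (auto simp: block_edges_def)
  show "equiv A (block_edges P)"
    unfolding eq using assms by (rule equiv_partition_on)
  show "A // block_edges P = P"
    unfolding eq by (rule partition_on_eq_quotient[OF assms])
qed

lemma product_graph_eq:
  "product_graph a b =
     map_prod low_to_mid low_to_mid ` block_edges a \<union> map_prod up_to_mid up_to_mid ` block_edges b"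
  unfolding product_graph_def block_edges_def rename_def by (auto simp: map_prod_def image_iff)

lemma block_edges_subset: "a \<in> partitions n \<Longrightarrow> block_edges a \<subseteq> outer_vertices n \<times> outer_vertices n"
  using partition_onD1 unfolding partitions_def block_edges_def by fastforce

lemma product_graph_subset:
  assumes "a \<in> partitions n" "b \<in> partitions n"
  shows "product_graph a b \<subseteq>
    (outer_vertices n \<union> middle_vertices n) \<times> (outer_vertices n \<union> middle_vertices n)"
proof -
  have "low_to_mid x \<in> outer_vertices n \<union> middle_vertices n"
    "up_to_mid x \<in> outer_vertices n \<union> middle_vertices n" if "x \<in> outer_vertices n" for x
    using that by (auto simp: outer_vertices_def middle_vertices_def)
  then show ?thesis
    using block_edges_subset[OF assms(1)] block_edges_subset[OF assms(2)]
    unfolding product_graph_eq by fastforce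
qed

lemma sym_product_graph: "sym (product_graph a b)"
  unfolding product_graph_def block_edges_def sym_def by blast

lemma equiv_connected_outer:
  "equiv (outer_vertices n)
     {(x, y) \<in> outer_vertices n \<times> outer_vertices n. (x, y) \<in> (product_graph a b)\<^sup>*}"
proof (rule equivI)
  show "sym {(x, y) \<in> outer_vertices n \<times> outer_vertices n. (x, y) \<in> (product_graph a b)\<^sup>*}"
    using sym_rtrancl[OF sym_product_graph[of a b]] by (auto simp: sym_def)
qed (auto simp: refl_on_def trans_def)

lemma block_edges_product:
  "block_edges (diagram_product n a b) =
     {(x, y) \<in> outer_vertices n \<times> outer_vertices n. (x, y) \<in> (product_graph a b)\<^sup>*}"
  unfolding diagram_product_def by (rule block_edges_quotient[OF equiv_connected_outer])

lemma diagram_product_in_partitions: "diagram_product n a b \<in> partitions n"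
  unfolding diagram_product_def partitions_def
  using partition_on_quotient[OF equiv_connected_outer] by blast

section \<open>Partitions given by labellings of the vertices\<close>

fun label :: "(nat \<Rightarrow> nat) \<Rightarrow> (nat \<Rightarrow> nat) \<Rightarrow> (nat \<Rightarrow> nat) \<Rightarrow> vertex \<Rightarrow> nat" where
  "label u m v (Up i) = u i"
| "label u m v (Mid i) = m i"
| "label u m v (Low i) = v i"

definition fibres :: "nat \<Rightarrow> (vertex \<Rightarrow> nat) \<Rightarrow> diagram" where
  "fibres n h = outer_vertices n // {(x, y) \<in> outer_vertices n \<times> outer_vertices n. h x = h y}"

text \<open>Partitions have no middle vertices, so any labelling can fill the middle slot;
  \<open>labelled_eq_fibres\<close> replaces \<open>u\<close> there by whichever \<open>m\<close>
  suits a given product graph.\<close>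

definition labelled :: "nat \<Rightarrow> (nat \<Rightarrow> nat) \<Rightarrow> (nat \<Rightarrow> nat) \<Rightarrow> diagram" where
  "labelled n u v = fibres n (label u u v)"

lemma equiv_fibres:
  "equiv (outer_vertices n) {(x, y) \<in> outer_vertices n \<times> outer_vertices n. h x = h y}"
  by (rule equivI) (auto simp: refl_on_def sym_def trans_def)

lemma fibres_cong:
  assumes "\<And>x y. x \<in> outer_vertices n \<Longrightarrow> y \<in> outer_vertices n \<Longrightarrow> h x = h y \<longleftrightarrow> k x = k y"
  shows "fibres n h = fibres n k"
proof -
  have "{(x, y) \<in> outer_vertices n \<times> outer_vertices n. h x = h y} =
      {(x, y) \<in> outer_vertices n \<times> outer_vertices n. k x = k y}"
    using assms by auto
  then show ?thesis unfolding fibres_def by simp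
qed

lemma labelled_eq_fibres: "labelled n u v = fibres n (label u m v)"
  unfolding labelled_def by (rule fibres_cong) (auto simp: outer_vertices_def)

lemma labelled_in_partitions: "labelled n u v \<in> partitions n"
  unfolding labelled_def fibres_def partitions_def
  using partition_on_quotient[OF equiv_fibres] by blast

lemma block_edges_labelled:
  "block_edges (labelled n u v) =
     {(x, y) \<in> outer_vertices n \<times> outer_vertices n. label u m v x = label u m v y}"
  unfolding labelled_eq_fibres[of n u v m] fibres_def by (rule block_edges_quotient[OF equiv_fibres])

text \<open>A partition has finitely many blocks, so they can be numbered injectively; labelling
  each vertex by the number of its block recovers the partition.\<close>

lemma labelled_cases:
  assumes "a \<in> partitions n"
  obtains u v where "a = labelled n u v"
proof -
  have P: "partition_on (outer_vertices n) a"
    using assms by (simp add: partitions_def)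
  have fin: "finite a"
    using finite_elements[OF _ P] by (simp add: outer_vertices_def)
  obtain f :: "vertex set \<Rightarrow> nat" where f: "inj_on f a"
    using finite_imp_inj_to_nat_seg[OF fin] by blast
  define h where "h x = f (block_edges a `` {x})" for x
  have eq: "equiv (outer_vertices n) (block_edges a)" and q: "outer_vertices n // block_edges a = a"
    using quotient_block_edges[OF P] by auto
  have "h x = h y \<longleftrightarrow> (x, y) \<in> block_edges a" if "x \<in> outer_vertices n" "y \<in> outer_vertices n" for x y
  proof -
    have "block_edges a `` {x} \<in> a" "block_edges a `` {y} \<in> a"
      using that q quotientI by metis+
    then show ?thesis
      unfolding h_def using f eq that by (metis eq_equiv_class_iff inj_on_eq_iff)
  qed
  then have "{(x, y) \<in> outer_vertices n \<times> outer_vertices n. h x = h y} = block_edges a"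
    using block_edges_subset[OF assms] by auto
  then have "a = fibres n h"
    using q by (simp add: fibres_def)
  also have "\<dots> = labelled n (h \<circ> Up) (h \<circ> Low)"
    unfolding labelled_def by (rule fibres_cong) (auto simp: outer_vertices_def)
  finally show thesis using that by blast
qed

section \<open>Products and floating components read off from labels\<close>

text \<open>The hypotheses make the fibres of \<open>h\<close> on all three rows exactly the
  components of the product graph. Floating components then correspond to the labels attained in the
  middle row but in neither outer row.\<close>

lemma product_by_labelling:
  fixes h :: "vertex \<Rightarrow> nat"
  assumes ab: "a \<in> partitions n" "b \<in> partitions n"
    and edges: "\<And>x y. (x, y) \<in> product_graph a b \<Longrightarrow> h x = h y"
    and conn: "\<And>x y. x \<in> outer_vertices n \<union> middle_vertices n \<Longrightarrow>
      y \<in> outer_vertices n \<union> middle_vertices n \<Longrightarrow> h x = h y \<Longrightarrow> (x, y) \<in> (product_graph a b)\<^sup>*"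
  shows "diagram_product n a b = fibres n h"
    and "canonical_twisting n a b = card (h ` middle_vertices n - h ` outer_vertices n)"
proof -
  let ?V = "outer_vertices n \<union> middle_vertices n"
  have path: "h x = h y" if "(x, y) \<in> (product_graph a b)\<^sup>*" for x y
    using that by (induction rule: rtrancl_induct) (simp, metis edges)
  have "(x, y) \<in> (product_graph a b)\<^sup>* \<longleftrightarrow> h x = h y"
    if "x \<in> outer_vertices n" "y \<in> outer_vertices n" for x y
    using path[of x y] conn[of x y] that by blast
  then have "{(x, y) \<in> outer_vertices n \<times> outer_vertices n. (x, y) \<in> (product_graph a b)\<^sup>*} =
      {(x, y) \<in> outer_vertices n \<times> outer_vertices n. h x = h y}"
    by auto
  then show "diagram_product n a b = fibres n h"
    by (simp add: diagram_product_def fibres_def)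
  \<comment> \<open>\<open>F l\<close> is the component with label \<open>l\<close>. For attained
    labels it is nonempty, so counting floating components amounts to counting their labels.\<close>
  define F where "F l = {y \<in> ?V. h y = l}" for l
  have cls: "(product_graph a b)\<^sup>* `` {x} = F (h x)" if "x \<in> ?V" for x
  proof -
    have "y \<in> ?V" if "(x, y) \<in> (product_graph a b)\<^sup>*" for y
      using that \<open>x \<in> ?V\<close>
      by (induction rule: rtrancl_induct) (use product_graph_subset[OF ab] in auto)
    then have "(x, y) \<in> (product_graph a b)\<^sup>* \<longleftrightarrow> y \<in> ?V \<and> h y = h x" for y
      using path[of x y] conn[OF that, of y] by metis
    then show ?thesis
      unfolding F_def by auto
  qed
  have "components ?V (product_graph a b) = F ` h ` ?V"
    unfolding components_def quotient_def image_image UNION_singleton_eq_range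
    using cls by (rule image_cong[OF refl])
  then have "{C \<in> components ?V (product_graph a b). C \<subseteq> middle_vertices n} =
      F ` {l \<in> h ` ?V. F l \<subseteq> middle_vertices n}"
    by auto
  moreover have "{l \<in> h ` ?V. F l \<subseteq> middle_vertices n} = h ` middle_vertices n - h ` outer_vertices n"
  proof -
    have disj: "z \<notin> middle_vertices n" if "z \<in> outer_vertices n" for z
      using that by (auto simp: outer_vertices_def middle_vertices_def)
    have "F l \<subseteq> middle_vertices n \<longleftrightarrow> l \<notin> h ` outer_vertices n" for l
      using disj unfolding F_def by (simp only: subset_iff image_iff mem_Collect_eq Un_iff) metis
    then show ?thesis
      by auto
  qed
  moreover have "inj_on F (h ` middle_vertices n)"
  proof (rule inj_onI)
    fix l l' assume "l \<in> h ` middle_vertices n" and eq: "F l = F l'"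
    then obtain y where "y \<in> F l" "h y = l" unfolding F_def by auto
    then show "l = l'" using eq unfolding F_def by blast
  qed
  then have "inj_on F (h ` middle_vertices n - h ` outer_vertices n)"
    by (rule inj_on_subset) (rule Diff_subset)
  ultimately show "canonical_twisting n a b = card (h ` middle_vertices n - h ` outer_vertices n)"
    unfolding canonical_twisting_def by (simp only: card_image)
qed

lemma label_outer_image: "label u m v ` outer_vertices n = u ` {1..n} \<union> v ` {1..n}"
  and label_middle_image: "label u m v ` middle_vertices n = m ` {1..n}"
  by (auto simp: outer_vertices_def middle_vertices_def image_Un image_image)

lemma product_graph_labelledI:
  assumes "i \<in> {1..n}" "j \<in> {1..n}"
  shows "u i = u j \<Longrightarrow> (Up i, Up j) \<in> product_graph (labelled n u g) (labelled n k v)"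
    and "u i = g j \<Longrightarrow> (Up i, Mid j) \<in> product_graph (labelled n u g) (labelled n k v)"
    and "g i = g j \<Longrightarrow> (Mid i, Mid j) \<in> product_graph (labelled n u g) (labelled n k v)"
    and "k i = k j \<Longrightarrow> (Mid i, Mid j) \<in> product_graph (labelled n u g) (labelled n k v)"
    and "k i = v j \<Longrightarrow> (Mid i, Low j) \<in> product_graph (labelled n u g) (labelled n k v)"
    and "v i = v j \<Longrightarrow> (Low i, Low j) \<in> product_graph (labelled n u g) (labelled n k v)"
proof -
  let ?E = "product_graph (labelled n u g) (labelled n k v)"
  have l: "(low_to_mid x, low_to_mid y) \<in> ?E"
    if "x \<in> outer_vertices n" "y \<in> outer_vertices n" "label u u g x = label u u g y" for x y
    unfolding product_graph_eq block_edges_labelled[of n u g u]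
    by (rule UnI1, rule image_eqI[of _ _ "(x, y)"]) (simp_all add: that)
  have r: "(up_to_mid x, up_to_mid y) \<in> ?E"
    if "x \<in> outer_vertices n" "y \<in> outer_vertices n" "label k k v x = label k k v y" for x y
    unfolding product_graph_eq block_edges_labelled[of n k v k]
    by (rule UnI2, rule image_eqI[of _ _ "(x, y)"]) (simp_all add: that)
  have o: "Up i \<in> outer_vertices n" "Low i \<in> outer_vertices n"
    "Up j \<in> outer_vertices n" "Low j \<in> outer_vertices n"
    using assms by (auto simp: outer_vertices_def)
  show "u i = u j \<Longrightarrow> (Up i, Up j) \<in> ?E" using l[OF o(1) o(3)] by simp
  show "u i = g j \<Longrightarrow> (Up i, Mid j) \<in> ?E" using l[OF o(1) o(4)] by simp
  show "g i = g j \<Longrightarrow> (Mid i, Mid j) \<in> ?E" using l[OF o(2) o(4)] by simp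
  show "k i = k j \<Longrightarrow> (Mid i, Mid j) \<in> ?E" using r[OF o(1) o(3)] by simp
  show "k i = v j \<Longrightarrow> (Mid i, Low j) \<in> ?E" using r[OF o(1) o(4)] by simp
  show "v i = v j \<Longrightarrow> (Low i, Low j) \<in> ?E" using r[OF o(2) o(4)] by simp
qed

lemma product_graph_labelledE:
  assumes "(x, y) \<in> product_graph (labelled n u g) (labelled n k v)"
  obtains x' y' where "x' \<in> outer_vertices n" "y' \<in> outer_vertices n"
      "label u u g x' = label u u g y'" "x = low_to_mid x'" "y = low_to_mid y'"
  | x' y' where "x' \<in> outer_vertices n" "y' \<in> outer_vertices n"
      "label k k v x' = label k k v y'" "x = up_to_mid x'" "y = up_to_mid y'"
  using assms unfolding product_graph_eq block_edges_labelled[of n u g u] block_edges_labelled[of n k v k]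
proof (elim UnE imageE, goal_cases)
  case (1 p)
  show ?case by (rule 1(1)[of "fst p" "snd p"]) (use 1(3,4) in \<open>simp_all add: case_prod_beta map_prod_def\<close>)
next
  case (2 p)
  show ?case by (rule 2(2)[of "fst p" "snd p"]) (use 2(3,4) in \<open>simp_all add: case_prod_beta map_prod_def\<close>)
qed

text \<open>The middle row carries the labels \<open>g\<close> from the left factor and
  \<open>k\<close> from the right one; \<open>m\<close> is the labelling that results from gluing.
  The first four hypotheses say that every edge preserves \<open>label u m v\<close>. The remaining
  ones give paths: middle vertices with equal labels are joined by an edge of one factor, an outer
  label that occurs in \<open>m\<close> is linked to the middle row by its own factor, and a label
  common to both outer rows passes through the middle.\<close>

lemma labelled_product:
  assumes g: "\<And>i j. i \<in> {1..n} \<Longrightarrow> j \<in> {1..n} \<Longrightarrow> g i = g j \<Longrightarrow> m i = m j"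
    and ug: "\<And>i j. i \<in> {1..n} \<Longrightarrow> j \<in> {1..n} \<Longrightarrow> u i = g j \<Longrightarrow> m j = u i"
    and k: "\<And>i j. i \<in> {1..n} \<Longrightarrow> j \<in> {1..n} \<Longrightarrow> k i = k j \<Longrightarrow> m i = m j"
    and vk: "\<And>i j. i \<in> {1..n} \<Longrightarrow> j \<in> {1..n} \<Longrightarrow> v i = k j \<Longrightarrow> m j = v i"
    and m: "\<And>i j. i \<in> {1..n} \<Longrightarrow> j \<in> {1..n} \<Longrightarrow> m i = m j \<Longrightarrow> g i = g j \<or> k i = k j"
    and um: "u ` {1..n} \<inter> m ` {1..n} \<subseteq> g ` {1..n}"
    and vm: "v ` {1..n} \<inter> m ` {1..n} \<subseteq> k ` {1..n}"
    and uv: "u ` {1..n} \<inter> v ` {1..n} \<subseteq> m ` {1..n}"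
  shows "diagram_product n (labelled n u g) (labelled n k v) = labelled n u v"
    and "canonical_twisting n (labelled n u g) (labelled n k v) =
      card (m ` {1..n} - (u ` {1..n} \<union> v ` {1..n}))"
proof -
  let ?E = "product_graph (labelled n u g) (labelled n k v)"
  let ?V = "outer_vertices n \<union> middle_vertices n"
  have sym: "(y, x) \<in> ?E\<^sup>*" if "(x, y) \<in> ?E\<^sup>*" for x y
    using that by (rule symD[OF sym_rtrancl[OF sym_product_graph]])
  note edge = product_graph_labelledI[where n = n and u = u and g = g and k = k and v = v]
  have edges: "label u m v x = label u m v y" if "(x, y) \<in> ?E" for x y
    using that
  proof (cases rule: product_graph_labelledE)
    case (1 x' y')
    show ?thesis using 1 unfolding outer_vertices_def
      by - (elim UnE imageE; simp del: atLeastAtMost_iff One_nat_def; metis g ug)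
  next
    case (2 x' y')
    show ?thesis using 2 unfolding outer_vertices_def
      by - (elim UnE imageE; simp del: atLeastAtMost_iff One_nat_def; metis k vk)
  qed
  have mm: "(Mid i, Mid j) \<in> ?E\<^sup>*" if "i \<in> {1..n}" "j \<in> {1..n}" "m i = m j" for i j
    using m[OF that] edge(3,4)[OF that(1,2)] by blast
  \<comment> \<open>The path first enters the middle row at some \<open>l\<close> with
    \<open>g l = u i\<close>, then moves along that row to \<open>j\<close>.\<close>
  have um': "(Up i, Mid j) \<in> ?E\<^sup>*" if ij: "i \<in> {1..n}" "j \<in> {1..n}" "u i = m j" for i j
  proof -
    obtain l where l: "l \<in> {1..n}" "u i = g l" using ij um by blast
    then have "m l = m j" using ug[of i l] ij by simp
    then show ?thesis
      by (rule converse_rtrancl_into_rtrancl[OF edge(2)[OF ij(1) l] mm[OF l(1) ij(2)]])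
  qed
  have vm': "(Mid j, Low i) \<in> ?E\<^sup>*" if ij: "i \<in> {1..n}" "j \<in> {1..n}" "v i = m j" for i j
  proof -
    obtain l where l: "l \<in> {1..n}" "v i = k l" using ij vm by blast
    then have "m j = m l" using vk[of i l] ij by simp
    then show ?thesis
      by (rule rtrancl.rtrancl_into_rtrancl[OF mm[OF ij(2) l(1)] edge(5)[OF l(1) ij(1) l(2)[symmetric]]])
  qed
  have uv': "(Up i, Low j) \<in> ?E\<^sup>*" if ij: "i \<in> {1..n}" "j \<in> {1..n}" "u i = v j" for i j
  proof -
    obtain l where l: "l \<in> {1..n}" "u i = m l" using ij uv by blast
    then have "v j = m l" using ij(3) by simp
    then show ?thesis
      by (rule rtrancl_trans[OF um'[OF ij(1) l] vm'[OF ij(2) l(1)]])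
  qed
  have uu': "(Up i, Up j) \<in> ?E\<^sup>*" if ij: "i \<in> {1..n}" "j \<in> {1..n}" "u i = u j" for i j
    using edge(1)[OF that(1,2)] that(3) by blast
  have vv': "(Low i, Low j) \<in> ?E\<^sup>*" if ij: "i \<in> {1..n}" "j \<in> {1..n}" "v i = v j" for i j
    using edge(6)[OF that(1,2)] that(3) by blast
  have conn: "(x, y) \<in> ?E\<^sup>*" if "x \<in> ?V" "y \<in> ?V" "label u m v x = label u m v y" for x y
  proof -
    have V: "Up i \<in> ?V \<longleftrightarrow> i \<in> {1..n}" "Mid i \<in> ?V \<longleftrightarrow> i \<in> {1..n}"
      "Low i \<in> ?V \<longleftrightarrow> i \<in> {1..n}" for i
      by (auto simp: outer_vertices_def middle_vertices_def)
    note path = mm um' vm' uv' uu' vv' sym[OF um'] sym[OF vm'] sym[OF uv']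
    show ?thesis
      using that
      by - (cases x; cases y; simp only: V label.simps; (rule path; (assumption | simp only:)))
  qed
  have "diagram_product n (labelled n u g) (labelled n k v) = fibres n (label u m v)"
    by (rule product_by_labelling(1)[OF labelled_in_partitions labelled_in_partitions])
      (erule edges, rule conn)
  then show "diagram_product n (labelled n u g) (labelled n k v) = labelled n u v"
    by (simp only: labelled_eq_fibres[of n u v m])
  have "canonical_twisting n (labelled n u g) (labelled n k v) =
      card (label u m v ` middle_vertices n - label u m v ` outer_vertices n)"
    by (rule product_by_labelling(2)[OF labelled_in_partitions labelled_in_partitions])
      (erule edges, rule conn)
  then show "canonical_twisting n (labelled n u g) (labelled n k v) =
      card (m ` {1..n} - (u ` {1..n} \<union> v ` {1..n}))"
    by (simp only: label_outer_image label_middle_image)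
qed

lemma labelled_product_zero:
  assumes "\<And>i j. i \<in> {1..n} \<Longrightarrow> j \<in> {1..n} \<Longrightarrow> g i = g j \<Longrightarrow> m i = m j"
    and "\<And>i j. i \<in> {1..n} \<Longrightarrow> j \<in> {1..n} \<Longrightarrow> u i = g j \<Longrightarrow> m j = u i"
    and "\<And>i j. i \<in> {1..n} \<Longrightarrow> j \<in> {1..n} \<Longrightarrow> k i = k j \<Longrightarrow> m i = m j"
    and "\<And>i j. i \<in> {1..n} \<Longrightarrow> j \<in> {1..n} \<Longrightarrow> v i = k j \<Longrightarrow> m j = v i"
    and "\<And>i j. i \<in> {1..n} \<Longrightarrow> j \<in> {1..n} \<Longrightarrow> m i = m j \<Longrightarrow> g i = g j \<or> k i = k j"
    and "u ` {1..n} \<inter> m ` {1..n} \<subseteq> g ` {1..n}"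
    and "v ` {1..n} \<inter> m ` {1..n} \<subseteq> k ` {1..n}"
    and "u ` {1..n} \<inter> v ` {1..n} \<subseteq> m ` {1..n}"
    and "m ` {1..n} \<subseteq> u ` {1..n} \<union> v ` {1..n}"
  shows "diagram_product n (labelled n u g) (labelled n k v) = labelled n u v \<and>
    canonical_twisting n (labelled n u g) (labelled n k v) = 0"
proof
  show "diagram_product n (labelled n u g) (labelled n k v) = labelled n u v"
    using assms(1-8) by (rule labelled_product(1))
  have "canonical_twisting n (labelled n u g) (labelled n k v) =
      card (m ` {1..n} - (u ` {1..n} \<union> v ` {1..n}))"
    using assms(1-8) by (rule labelled_product(2))
  moreover have "m ` {1..n} - (u ` {1..n} \<union> v ` {1..n}) = {}"
    using assms(9) by blast
  ultimately show "canonical_twisting n (labelled n u g) (labelled n k v) = 0"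
    by (simp only: card.empty)
qed

text \<open>This is the case where \<open>k\<close> and \<open>m\<close> are both \<open>g\<close>:
  factors that agree on the middle labelling compose by forgetting it, as long as every label common
  to \<open>u\<close> and \<open>v\<close> can pass through.\<close>

lemma labelled_product_same_middle:
  assumes "u ` {1..n} \<inter> v ` {1..n} \<subseteq> g ` {1..n}"
  shows "diagram_product n (labelled n u g) (labelled n g v) = labelled n u v"
    and "canonical_twisting n (labelled n u g) (labelled n g v) =
      card (g ` {1..n} - (u ` {1..n} \<union> v ` {1..n}))"
  by (rule labelled_product[of n g g u g v]; use assms in simp)+

section \<open>Membership in the submonoid generated by the idempotents\<close>

abbreviation twisted_generated :: "nat \<Rightarrow> (nat \<times> diagram) set" where
  "twisted_generated n \<equiv>
     generated_submonoid (twisted_partition_monoid n) (idempotents (twisted_partition_monoid n))"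

lemma twisted_generated_idempotent:
  assumes "a \<in> partitions n" "diagram_product n a a = a" "canonical_twisting n a a = 0"
  shows "(0, a) \<in> twisted_generated n"
proof -
  have "(0, a) \<in> idempotents (twisted_partition_monoid n)"
    using assms by (simp add: idempotents_def twisted_product_def partition_monoid_def)
  then show ?thesis
    unfolding generated_submonoid_def by (rule hull_inc)
qed

text \<open>The hull is an intersection, so it suffices to multiply inside each submonoid that
  contains the idempotents.\<close>

lemma twisted_generated_mult:
  assumes "(i, a) \<in> twisted_generated n" "(j, b) \<in> twisted_generated n"
  shows "(i + j + canonical_twisting n a b, diagram_product n a b) \<in> twisted_generated n"
proof -
  have "(i, a) \<otimes>\<^bsub>twisted_partition_monoid n\<^esub> (j, b) \<in> H"
    if "submonoid H (twisted_partition_monoid n)" "idempotents (twisted_partition_monoid n) \<subseteq> H" for H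
    using assms that submonoid.m_closed[OF that(1)]
    unfolding generated_submonoid_def hull_def by blast
  then show ?thesis
    unfolding generated_submonoid_def hull_def
    by (simp add: twisted_product_def partition_monoid_def)
qed

lemma twisted_generated_same_middle:
  assumes "(i, labelled n u g) \<in> twisted_generated n" "(j, labelled n g v) \<in> twisted_generated n"
    and "u ` {1..n} \<inter> v ` {1..n} \<subseteq> g ` {1..n}"
  shows "(i + j + card (g ` {1..n} - (u ` {1..n} \<union> v ` {1..n})), labelled n u v) \<in> twisted_generated n"
  using twisted_generated_mult[OF assms(1,2)] labelled_product_same_middle[OF assms(3)] by simp

section \<open>Pairs of surjections onto fewer than \<open>n\<close> labels\<close>

text \<open>The overwritten value survives at \<open>p\<close>, and the new value is already
  attained.\<close>

lemma image_fun_upd_repeated: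
  assumes "p \<in> A" "p \<noteq> q" "f p = f q" "t \<in> f ` A" "q \<in> A"
  shows "f(q := t) ` A = f ` A"
proof
  show "f(q := t) ` A \<subseteq> f ` A" using assms by auto
  show "f ` A \<subseteq> f(q := t) ` A"
  proof clarify
    fix i assume "i \<in> A"
    then show "f i \<in> f(q := t) ` A"
      using assms by (cases "i = q") (auto intro: rev_image_eqI)
  qed
qed

text \<open>If \<open>f q\<close> is attained elsewhere, it may be changed at \<open>q\<close>: the left factor
  \<open>labelled n f (f(q := z))\<close> with a fresh label \<open>z\<close> cuts the lower copy of \<open>q\<close> off its block.\<close>

lemma twisted_generated_move:
  assumes pq: "p \<in> {1..n}" "q \<in> {1..n}" "p \<noteq> q" "f p = f q"
    and t: "t \<in> f ` {1..n}" and g: "g ` {1..n} = f ` {1..n}"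
    and gen: "(0, labelled n (f(q := t)) g) \<in> twisted_generated n"
  shows "(0, labelled n f g) \<in> twisted_generated n"
proof -
  obtain z where z: "z \<notin> f ` {1..n}"
    using ex_new_if_finite[of "f ` {1..n}"] by auto
  let ?h = "f(q := z)" and ?f = "f(q := t)"
  have z': "f i \<noteq> z" if "i \<in> {1..n}" for i
    using z that by blast
  have h: "f ` {1..n} \<subseteq> ?h ` {1..n}"
  proof clarify
    fix i assume "i \<in> {1..n}"
    then show "f i \<in> ?h ` {1..n}"
      using pq by (cases "i = q") (auto intro: rev_image_eqI)
  qed
  have f: "?f ` {1..n} \<subseteq> f ` {1..n}"
    using t by auto
  have idem: "diagram_product n (labelled n f ?h) (labelled n f ?h) = labelled n f ?h \<and>
    canonical_twisting n (labelled n f ?h) (labelled n f ?h) = 0"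
  \<comment> \<open>The left copy isolates \<open>q\<close> in the middle row, but the right copy
    rejoins it to its \<open>f\<close>-class. The middle row is thus labelled by \<open>f\<close>,
    and nothing floats.\<close>
  proof (rule labelled_product_zero[where m = f])
    show "f ` {1..n} \<inter> f ` {1..n} \<subseteq> ?h ` {1..n}" using h by blast
  qed (use z' in \<open>auto split: if_splits\<close>)
  have prod: "diagram_product n (labelled n f ?h) (labelled n ?f g) = labelled n f g \<and>
    canonical_twisting n (labelled n f ?h) (labelled n ?f g) = 0"
  \<comment> \<open>Since \<open>q\<close> is cut off from the left, its middle vertex takes the
    label \<open>t\<close> from the right factor.\<close>
  proof (rule labelled_product_zero[where m = ?f])
    show "f ` {1..n} \<inter> ?f ` {1..n} \<subseteq> ?h ` {1..n}" using h by blast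
    show "f ` {1..n} \<inter> g ` {1..n} \<subseteq> ?f ` {1..n}"
    proof clarify
      fix i assume "i \<in> {1..n}"
      then show "f i \<in> ?f ` {1..n}"
        using pq by (cases "i = q") (auto intro: rev_image_eqI)
    qed
    show "?f ` {1..n} \<subseteq> f ` {1..n} \<union> g ` {1..n}" using f by blast
  qed (use z' in \<open>auto split: if_splits\<close>)
  show ?thesis
    using twisted_generated_mult[OF twisted_generated_idempotent[OF labelled_in_partitions
          conjunct1[OF idem] conjunct2[OF idem]] gen] by (simp only: prod add_0)
qed

text \<open>Induction on the number of places where \<open>f\<close> and \<open>g\<close> differ. If
  the value at such a place is repeated elsewhere, it can be overwritten by the correct one
  directly. Otherwise \<open>card K < n\<close> supplies a repeated value, and its second occurrence
  serves as a spare place through which other values are shifted.\<close>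

lemma twisted_generated_surjections:
  assumes "f ` {1..n} = K" "g ` {1..n} = K" "card K < n"
  shows "(0, labelled n f g) \<in> twisted_generated n"
  using assms
proof (induction "card {i \<in> {1..n}. f i \<noteq> g i}" arbitrary: f rule: less_induct)
  case less
  note f = \<open>f ` {1..n} = K\<close> and g = \<open>g ` {1..n} = K\<close>
  show ?case
  proof (cases "\<exists>i\<in>{1..n}. f i \<noteq> g i")
    case False
    then have "labelled n f g = labelled n g g"
      unfolding labelled_def by (intro fibres_cong) (auto simp: outer_vertices_def)
    moreover have "(0, labelled n g g) \<in> twisted_generated n"
      by (rule twisted_generated_idempotent[OF labelled_in_partitions])
        (simp_all add: labelled_product_same_middle)
    ultimately show ?thesis by simp
  next
    case True
    then obtain i where i: "i \<in> {1..n}" "f i \<noteq> g i" by blast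
    show ?thesis
    proof (cases "\<exists>q p. q \<in> {1..n} \<and> p \<in> {1..n} \<and> f q \<noteq> g q \<and> p \<noteq> q \<and> f p = f q")
      case True
      then obtain q p where qp: "q \<in> {1..n}" "p \<in> {1..n}" "f q \<noteq> g q" "p \<noteq> q" "f p = f q"
        by blast
      let ?f = "f(q := g q)"
      have "g q \<in> f ` {1..n}" using f g qp(1) by blast
      from image_fun_upd_repeated[OF qp(2,4,5) this qp(1)] f have "?f ` {1..n} = K"
        by (rule trans)
      moreover have "card {i \<in> {1..n}. ?f i \<noteq> g i} < card {i \<in> {1..n}. f i \<noteq> g i}"
        using qp by (intro psubset_card_mono) auto
      ultimately have "(0, labelled n ?f g) \<in> twisted_generated n"
        by (intro less.hyps g \<open>card K < n\<close>)
      then show ?thesis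
        by (rule twisted_generated_move[OF qp(2,1,4,5) \<open>g q \<in> f ` {1..n}\<close>, rotated]) (simp only: f g)
    next
      case single: False
      \<comment> \<open>\<open>w\<close> is a place where the value \<open>f i\<close>
        belongs.\<close>
      obtain w where w: "w \<in> {1..n}" "g w = f i"
        using f g i(1) by (metis image_iff)
      have wi: "w \<noteq> i" using i w by auto
      have fw: "f w \<noteq> f i" using single i w(1) wi by blast
      have "\<not> inj_on f {1..n}"
      proof
        assume "inj_on f {1..n}"
        from card_image[OF this] show False using f \<open>card K < n\<close> by simp
      qed
      then obtain p q where pq: "p \<in> {1..n}" "q \<in> {1..n}" "p \<noteq> q" "f p = f q"
        unfolding inj_on_def by blast
      \<comment> \<open>In the present case no repeated value sits at a place where \<open>f\<close>
        and \<open>g\<close> differ.\<close>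
      have agree: "f p = g p" "f q = g q"
        using single pq(1,2) pq(3,4) pq(3,4)[symmetric] by blast+
      have ne: "p \<noteq> i" "q \<noteq> i" "p \<noteq> w" "q \<noteq> w" "w \<noteq> i"
        using agree i(2) w(2) fw wi by auto
      \<comment> \<open>Each change acts on a repeated value. Storing \<open>f w\<close> at the
        spare place \<open>q\<close> frees \<open>w\<close>; giving \<open>w\<close> its correct
        value \<open>f i\<close> frees \<open>i\<close>; then \<open>i\<close> receives its correct
        value \<open>g i\<close>.\<close>
      define f1 where "f1 = f(q := f w)"
      define f2 where "f2 = f1(w := f i)"
      define f3 where "f3 = f2(i := g i)"
      have im1: "f1 ` {1..n} = K"
        unfolding f1_def using image_fun_upd_repeated[OF pq(1,3,4) imageI[OF w(1)] pq(2)] f by (rule trans)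
      have "f i \<in> f1 ` {1..n}"
        unfolding im1 f[symmetric] using i(1) by (rule imageI)
      then have f1: "f1 q = f1 w" "f i \<in> f1 ` {1..n}"
        using ne unfolding f1_def by simp_all
      have im2: "f2 ` {1..n} = K"
        unfolding f2_def using image_fun_upd_repeated[OF pq(2) ne(4) f1 w(1)] im1 by (rule trans)
      have "g i \<in> f2 ` {1..n}"
        unfolding im2 g[symmetric] using i(1) by (rule imageI)
      then have f2: "f2 w = f2 i" "g i \<in> f2 ` {1..n}"
        using ne unfolding f2_def f1_def by simp_all
      have im3: "f3 ` {1..n} = K"
        unfolding f3_def using image_fun_upd_repeated[OF w(1) ne(5) f2 i(1)] im2 by (rule trans)
      \<comment> \<open>Both \<open>w\<close> and \<open>i\<close> have been mended and only
        \<open>q\<close> can have been spoilt, so the number of differences drops.\<close>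
      have "{j \<in> {1..n}. f3 j \<noteq> g j} \<subseteq> insert q ({j \<in> {1..n}. f j \<noteq> g j} - {w, i})"
        using w unfolding f3_def f2_def f1_def by auto
      then have "card {j \<in> {1..n}. f3 j \<noteq> g j} \<le> card (insert q ({j \<in> {1..n}. f j \<noteq> g j} - {w, i}))"
        by (rule card_mono[rotated]) simp
      also have "\<dots> \<le> Suc (card ({j \<in> {1..n}. f j \<noteq> g j} - {w, i}))"
        by (simp add: card_insert_if)
      also have "\<dots> < card {j \<in> {1..n}. f j \<noteq> g j}"
      proof -
        have "card {w, i} \<le> card {j \<in> {1..n}. f j \<noteq> g j}"
          using i w fw by (intro card_mono) auto
        moreover have "card ({j \<in> {1..n}. f j \<noteq> g j} - {w, i}) = card {j \<in> {1..n}. f j \<noteq> g j} - card {w, i}"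
          using i w fw by (intro card_Diff_subset) auto
        ultimately show ?thesis using ne by simp
      qed
      finally have "(0, labelled n f3 g) \<in> twisted_generated n"
        by (intro less.hyps im3 g \<open>card K < n\<close>)
      \<comment> \<open>The three changes are now undone in reverse order, each by one
        multiplication by an idempotent.\<close>
      then have "(0, labelled n (f2(i := g i)) g) \<in> twisted_generated n"
        unfolding f3_def .
      then have "(0, labelled n f2 g) \<in> twisted_generated n"
        by (rule twisted_generated_move[OF w(1) i(1) ne(5) f2, rotated])
          (simp only: im2 g)
      then have "(0, labelled n (f1(w := f i)) g) \<in> twisted_generated n"
        unfolding f2_def .
      then have "(0, labelled n f1 g) \<in> twisted_generated n"
        by (rule twisted_generated_move[OF pq(2) w(1) ne(4) f1, rotated])
          (simp only: im1 g)
      then have "(0, labelled n (f(q := f w)) g) \<in> twisted_generated n"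
        unfolding f1_def .
      then show ?thesis
        by (rule twisted_generated_move[OF pq imageI[OF w(1)], rotated]) (simp only: f g)
    qed
  qed
qed

section \<open>From surjections to arbitrary singular partitions and twists\<close>

text \<open>The factorisation is \<open>(u, f)\<close>, \<open>(f, g)\<close>,
  \<open>(g, v)\<close>, where \<open>f\<close> and \<open>g\<close> arise from \<open>u\<close> and
  \<open>v\<close> by merging all labels outside \<open>K\<close> into one label of
  \<open>K\<close>. The outer factors are idempotent and the middle one is a pair of surjections
  onto \<open>K\<close>.\<close>

lemma twisted_generated_positive_rank:
  assumes K: "K = u ` {1..n} \<inter> v ` {1..n}" "K \<noteq> {}" "card K < n"
  shows "(0, labelled n u v) \<in> twisted_generated n"
proof -
  obtain c where c: "c \<in> K" using K(2) by blast
  define f where "f i = (if u i \<in> K then u i else c)" for i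
  define g where "g i = (if v i \<in> K then v i else c)" for i
  have fi: "f i \<in> K" "g i \<in> K" for i
    using c by (simp_all add: f_def g_def)
  have fu: "f i = u i" if "u i \<in> K" for i
    using that by (simp add: f_def)
  have gv: "g i = v i" if "v i \<in> K" for i
    using that by (simp add: g_def)
  have Ku: "K \<subseteq> u ` {1..n}" and Kv: "K \<subseteq> v ` {1..n}"
    using K(1) by auto
  have "k \<in> f ` {1..n}" if k: "k \<in> K" for k
  proof -
    obtain i where "i \<in> {1..n}" "k = u i" using k Ku by blast
    then show ?thesis using fu[of i] k by (intro image_eqI[of _ _ i]) simp_all
  qed
  then have f: "f ` {1..n} = K"
    using fi(1) by blast
  have "k \<in> g ` {1..n}" if k: "k \<in> K" for k
  proof -
    obtain i where "i \<in> {1..n}" "k = v i" using k Kv by blast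
    then show ?thesis using gv[of i] k by (intro image_eqI[of _ _ i]) simp_all
  qed
  then have g: "g ` {1..n} = K"
    using fi(2) by blast
  have "diagram_product n (labelled n u f) (labelled n u f) = labelled n u f \<and>
      canonical_twisting n (labelled n u f) (labelled n u f) = 0"
  \<comment> \<open>The middle row of the square is glued by \<open>f\<close> from the left and by
    \<open>u\<close> from the right. As \<open>u\<close> refines \<open>f\<close>, the result is
    \<open>f\<close>, whose labels all occur in the outer rows.\<close>
  proof (rule labelled_product_zero[where m = f])
    show "f ` {1..n} \<inter> f ` {1..n} \<subseteq> u ` {1..n}" using f Ku by blast
    show "f ` {1..n} \<subseteq> u ` {1..n} \<union> f ` {1..n}" by blast
    show "f i = f j" if "u i = u j" for i j
      using that by (simp add: f_def)
    show "f j = f i" if "f i = u j" for i j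
      using fu[of j] fi(1)[of i] that by simp
  qed simp_all
  then have 1: "(0, labelled n u f) \<in> twisted_generated n"
    by (elim conjE) (rule twisted_generated_idempotent[OF labelled_in_partitions])
  have "diagram_product n (labelled n g v) (labelled n g v) = labelled n g v \<and>
      canonical_twisting n (labelled n g v) (labelled n g v) = 0"
  proof (rule labelled_product_zero[where m = g])
    show "g ` {1..n} \<inter> g ` {1..n} \<subseteq> v ` {1..n}" using g Kv by blast
    show "g ` {1..n} \<subseteq> g ` {1..n} \<union> v ` {1..n}" by blast
    show "g i = g j" if "v i = v j" for i j
      using that by (simp add: g_def)
    show "g j = g i" if "g i = v j" for i j
      using gv[of j] fi(2)[of i] that by simp
  qed simp_all
  then have 2: "(0, labelled n g v) \<in> twisted_generated n"
    by (elim conjE) (rule twisted_generated_idempotent[OF labelled_in_partitions])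
  have 3: "(0, labelled n f g) \<in> twisted_generated n"
    by (rule twisted_generated_surjections[OF f g K(3)])
  have "(0 + 0 + card (g ` {1..n} - (f ` {1..n} \<union> v ` {1..n})), labelled n f v) \<in> twisted_generated n"
    by (rule twisted_generated_same_middle[OF 3 2]) (unfold f g, rule Int_lower1)
  moreover have "g ` {1..n} - (f ` {1..n} \<union> v ` {1..n}) = {}"
    unfolding f g by blast
  ultimately have 4: "(0, labelled n f v) \<in> twisted_generated n"
    by (simp only: card.empty add_0)
  have "(0 + 0 + card (f ` {1..n} - (u ` {1..n} \<union> v ` {1..n})), labelled n u v) \<in> twisted_generated n"
    by (rule twisted_generated_same_middle[OF 1 4]) (unfold f K(1), rule subset_refl)
  moreover have "f ` {1..n} - (u ` {1..n} \<union> v ` {1..n}) = {}"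
    using f Ku by blast
  ultimately show ?thesis
    by (simp only: card.empty add_0)
qed

lemma twisted_generated_zero:
  assumes n: "n \<ge> 2" and K: "card (u ` {1..n} \<inter> v ` {1..n}) < n"
  shows "(0, labelled n u v) \<in> twisted_generated n"
proof (cases "u ` {1..n} \<inter> v ` {1..n} = {}")
  case False
  then show ?thesis
    using twisted_generated_positive_rank K by blast
next
  case True
  \<comment> \<open>Without transversal blocks, \<open>g\<close> borrows one label from each side.
    Both occur because \<open>n \<ge> 2\<close>, so \<open>(u, g)\<close> and \<open>(g, v)\<close>
    each have exactly one common label, and no label is confined to \<open>g\<close>.\<close>
  define g where "g i = (if i = 1 then u 1 else v 1)" for i :: nat
  have in_n: "1 \<in> {1..n}" "2 \<in> {1..n}" using n by auto
  have gN: "g ` {1..n} = {u 1, v 1}"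
  proof
    show "g ` {1..n} \<subseteq> {u 1, v 1}" by (auto simp: g_def)
    have "g 1 = u 1" "g 2 = v 1" by (simp_all add: g_def)
    then show "{u 1, v 1} \<subseteq> g ` {1..n}"
      using imageI[OF in_n(1), of g] imageI[OF in_n(2), of g] by simp
  qed
  have u1: "u 1 \<in> u ` {1..n}" and v1: "v 1 \<in> v ` {1..n}"
    using in_n(1) by (rule imageI)+
  then have u1': "u 1 \<notin> v ` {1..n}" and v1': "v 1 \<notin> u ` {1..n}"
    using True by blast+
  have g: "g ` {1..n} - (u ` {1..n} \<union> v ` {1..n}) = {}"
    unfolding gN using u1 v1 by blast
  have ug: "{u 1} = u ` {1..n} \<inter> g ` {1..n}" and gv: "{v 1} = g ` {1..n} \<inter> v ` {1..n}"
    unfolding gN using u1 v1 u1' v1' by (simp_all only: Int_insert_right Int_insert_left if_True if_False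
        Int_empty_left Int_empty_right)
  have "(0, labelled n u g) \<in> twisted_generated n"
    by (rule twisted_generated_positive_rank[OF ug]) (use n in simp_all)
  moreover have "(0, labelled n g v) \<in> twisted_generated n"
    by (rule twisted_generated_positive_rank[OF gv]) (use n in simp_all)
  ultimately have "(0 + 0 + card (g ` {1..n} - (u ` {1..n} \<union> v ` {1..n})), labelled n u v) \<in> twisted_generated n"
    by (rule twisted_generated_same_middle) (use True in blast)
  then show ?thesis
    by (simp only: g card.empty add_0)
qed

lemma ex_surjection_from_interval:
  fixes K :: "nat set"
  assumes "finite K" "K \<noteq> {}" "card K \<le> n"
  shows "\<exists>g. g ` {1..n} = K"
proof -
  have "\<exists>f. f ` K \<subseteq> {1..n} \<and> inj_on f K"
    using assms by (intro card_le_inj) auto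
  then obtain f :: "nat \<Rightarrow> nat" where f: "f ` K \<subseteq> {1..n}" "inj_on f K" by blast
  obtain c where c: "c \<in> K" using assms by blast
  \<comment> \<open>An injection of \<open>K\<close> into the interval is inverted; places outside
    its range are sent to \<open>c\<close> so as not to leave \<open>K\<close>.\<close>
  define g where "g i = (if i \<in> f ` K then inv_into K f i else c)" for i
  have "g i \<in> K" for i
    using c unfolding g_def by (simp add: inv_into_into)
  moreover have "k \<in> g ` {1..n}" if "k \<in> K" for k
  proof (rule image_eqI)
    show "k = g (f k)" using f that by (simp add: g_def)
    show "f k \<in> {1..n}" using f that by blast
  qed
  ultimately have "g ` {1..n} = K" by blast
  then show ?thesis by (intro exI[of _ g])
qed

text \<open>A label used only in the middle row of a factorisation is a floating component.\<close>

lemma twisted_generated_labelled: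
  assumes n: "n \<ge> 2" and K: "card (u ` {1..n} \<inter> v ` {1..n}) < n"
  shows "(k, labelled n u v) \<in> twisted_generated n"
  using K
proof (induction k arbitrary: u v)
  case 0
  then show ?case using twisted_generated_zero[OF n] by blast
next
  case (Suc k)
  let ?K = "u ` {1..n} \<inter> v ` {1..n}"
  \<comment> \<open>A middle labelling with values \<open>?K\<close> and a fresh \<open>z\<close>
    leaves the common labels of both factors unchanged and makes one component float, which raises
    the twist by one. The bound \<open>card ?K < n\<close> leaves room for \<open>z\<close>.\<close>
  have "\<exists>z. z \<notin> u ` {1..n} \<union> v ` {1..n}"
    by (rule ex_new_if_finite) auto
  then obtain z where z: "z \<notin> u ` {1..n} \<union> v ` {1..n}" by blast
  have "card (insert z ?K) \<le> n"
    using Suc.prems by (intro order_trans[OF card_insert_le_m1]) auto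
  then obtain g where g: "g ` {1..n} = insert z ?K"
    using ex_surjection_from_interval[of "insert z ?K" n] by auto
  have u: "u ` {1..n} \<inter> g ` {1..n} = ?K" and v: "g ` {1..n} \<inter> v ` {1..n} = ?K"
    and float: "g ` {1..n} - (u ` {1..n} \<union> v ` {1..n}) = {z}"
    using z unfolding g by blast+
  have "(0 + k + card (g ` {1..n} - (u ` {1..n} \<union> v ` {1..n})), labelled n u v) \<in> twisted_generated n"
  proof (rule twisted_generated_same_middle)
    show "(0, labelled n u g) \<in> twisted_generated n"
      using twisted_generated_zero[OF n] u Suc.prems by (simp only:)
    show "(k, labelled n g v) \<in> twisted_generated n"
      using Suc.IH v Suc.prems by (simp only:)
    show "?K \<subseteq> g ` {1..n}" unfolding g by blast
  qed
  then show ?case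
    by (simp only: float) simp
qed

section \<open>Units recognised from the upper row\<close>

text \<open>This is a one-sided criterion for units: by counting, it also determines the lower row.
  Speaking of upper vertices and their links downwards, it passes from a product to its left
  factor.\<close>

definition joins_rows :: "nat \<Rightarrow> diagram \<Rightarrow> bool" where
  "joins_rows n a \<longleftrightarrow>
     (\<forall>i\<in>{1..n}. \<forall>j\<in>{1..n}. (Up i, Up j) \<in> block_edges a \<longrightarrow> i = j) \<and>
     (\<forall>i\<in>{1..n}. \<exists>j\<in>{1..n}. (Up i, Low j) \<in> block_edges a)"

lemma joins_rows_labelled:
  "joins_rows n (labelled n u v) \<longleftrightarrow> inj_on u {1..n} \<and> u ` {1..n} \<subseteq> v ` {1..n}"
proof -
  have "(Up i, Up j) \<in> block_edges (labelled n u v) \<longleftrightarrow> u i = u j"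
    "(Up i, Low j) \<in> block_edges (labelled n u v) \<longleftrightarrow> u i = v j"
    if "i \<in> {1..n}" "j \<in> {1..n}" for i j
    using that by (simp_all add: block_edges_labelled[of n u v u] outer_vertices_def)
  then show ?thesis
    unfolding joins_rows_def inj_on_def image_subset_iff image_iff by (simp only: cong: ball_cong bex_cong)
qed

lemma Up_connected_product:
  assumes "i \<in> {1..n}" "j \<in> {1..n}" "(Up i, Up j) \<in> block_edges a"
  shows "(Up i, Up j) \<in> block_edges (diagram_product n a b)"
proof -
  have "(Up i, Up j) \<in> product_graph a b"
    unfolding product_graph_eq
    by (rule UnI1, rule image_eqI[of _ _ "(Up i, Up j)"]) (simp_all add: assms)
  then show ?thesis
    using assms(1,2) by (auto simp: block_edges_product outer_vertices_def)
qed

text \<open>Upper vertices joined in \<open>a\<close> stay joined in the product, and a path can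
  leave the upper row only along a transversal block of \<open>a\<close>.\<close>

lemma joins_rows_left_factor:
  assumes a: "a \<in> partitions n" and b: "b \<in> partitions n"
    and ab: "joins_rows n (diagram_product n a b)"
  shows "joins_rows n a"
  unfolding joins_rows_def
proof (intro conjI ballI impI)
  fix i j assume "i \<in> {1..n}" "j \<in> {1..n}" "(Up i, Up j) \<in> block_edges a"
  then show "i = j"
    using Up_connected_product ab unfolding joins_rows_def by blast
next
  fix i assume i: "i \<in> {1..n}"
  then obtain j where j: "(Up i, Low j) \<in> (product_graph a b)\<^sup>*"
    using ab unfolding joins_rows_def block_edges_product by blast
  show "\<exists>j\<in>{1..n}. (Up i, Low j) \<in> block_edges a"
  proof (rule ccontr)
    assume no: "\<not> ?thesis"
    have eq: "equiv (outer_vertices n) (block_edges a)"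
      using a quotient_block_edges(1) by (simp add: partitions_def)
    \<comment> \<open>Invariant along a path: if the block of \<open>Up i\<close> has no lower
      vertex, the path never leaves the upper part of that block.\<close>
    have "\<exists>k. z = Up k \<and> (Up i, Up k) \<in> block_edges a" if "(Up i, z) \<in> (product_graph a b)\<^sup>*" for z
      using that
    proof (induction rule: rtrancl_induct)
      case base
      have "Up i \<in> outer_vertices n" using i by (simp add: outer_vertices_def)
      then show ?case using eq by (auto simp: equiv_def refl_on_def)
    next
      case (step y z)
      then obtain k where k: "y = Up k" "(Up i, Up k) \<in> block_edges a" by blast
      from step(2) consider
        x' z' where "(x', z') \<in> block_edges a" "y = low_to_mid x'" "z = low_to_mid z'"
        | x' z' where "(x', z') \<in> block_edges b" "y = up_to_mid x'"
        unfolding product_graph_eq by auto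
      then show ?case
      proof cases
        case 1
        then have outer: "x' \<in> outer_vertices n" "z' \<in> outer_vertices n"
          using block_edges_subset[OF a] by auto
        then have "x' = Up k" using 1 k by (auto simp: outer_vertices_def)
        then have iz: "(Up i, z') \<in> block_edges a"
          using 1 k eq by (meson equivE transD)
        then obtain l where "z' = Up l"
          using no outer(2) by (auto simp: outer_vertices_def)
        then show ?thesis using iz 1 by simp
      next
        case 2
        \<comment> \<open>\<open>up_to_mid\<close> sends outer vertices to the middle and lower
          rows, so no edge of \<open>b\<close> starts at \<open>Up k\<close>.\<close>
        then have "x' \<in> outer_vertices n" using block_edges_subset[OF b] by auto
        then show ?thesis using 2 k by (auto simp: outer_vertices_def)
      qed
    qed
    from this[OF j] show False by simp
  qed
qed

lemma one_partition_monoid: "\<one>\<^bsub>partition_monoid n\<^esub> = labelled n id id"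
proof -
  define r where "r = {(x, y) \<in> outer_vertices n \<times> outer_vertices n. label id id id x = label id id id y}"
  have r: "r `` {Up i} = {Up i, Low i}" "r `` {Low i} = {Up i, Low i}" if "i \<in> {1..n}" for i
    using that unfolding r_def outer_vertices_def by auto
  have "labelled n id id = outer_vertices n // r"
    by (simp add: labelled_def fibres_def r_def)
  also have "\<dots> = (\<lambda>x. r `` {x}) ` (Up ` {1..n} \<union> Low ` {1..n})"
    unfolding quotient_def outer_vertices_def by blast
  also have "\<dots> = (\<lambda>i. {Up i, Low i}) ` {1..n}"
    unfolding image_Un image_image using r by (simp cong: image_cong_simp)
  finally show ?thesis by (simp add: partition_monoid_def)
qed

lemma labelled_inj_eq_one:
  assumes "inj_on u {1..n}"
  shows "labelled n u u = \<one>\<^bsub>partition_monoid n\<^esub>"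
  unfolding one_partition_monoid labelled_def
  by (rule fibres_cong) (use assms in \<open>auto simp: outer_vertices_def inj_on_eq_iff\<close>)

text \<open>A unit is a left factor of the identity, which satisfies the criterion. Conversely, the
  criterion makes \<open>u\<close> and \<open>v\<close> injective with equal images, and the diagram
  turned upside down, \<open>labelled n v u\<close>, is the inverse.\<close>

lemma Units_iff_joins_rows:
  assumes a: "a \<in> partitions n"
  shows "a \<in> Units (partition_monoid n) \<longleftrightarrow> joins_rows n a"
proof
  assume "a \<in> Units (partition_monoid n)"
  then obtain c where c: "c \<in> partitions n" "diagram_product n a c = labelled n id id"
    unfolding Units_def one_partition_monoid by (auto simp: partition_monoid_def)
  have "joins_rows n (labelled n id id)" by (simp add: joins_rows_labelled)
  then show "joins_rows n a"
    using joins_rows_left_factor[OF a c(1)] c(2) by simp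
next
  assume Q: "joins_rows n a"
  obtain u v where a_eq: "a = labelled n u v" using a by (rule labelled_cases)
  have u: "inj_on u {1..n}" "u ` {1..n} \<subseteq> v ` {1..n}"
    using Q unfolding a_eq joins_rows_labelled by auto
  have cu: "card (u ` {1..n}) = n" using card_image[OF u(1)] by simp
  have cv: "card (v ` {1..n}) \<le> n" using card_image_le[of "{1..n}" v] by simp
  \<comment> \<open>\<open>u\<close> has \<open>n\<close> labels and \<open>v\<close> at most
    \<open>n\<close>, so the inclusion is an equality and \<open>v\<close> is injective as
    well.\<close>
  have uv: "u ` {1..n} = v ` {1..n}"
    using u(2) cu cv by (intro card_seteq) auto
  have v: "inj_on v {1..n}"
    by (rule eq_card_imp_inj_on) (use cu uv in simp_all)
  have "diagram_product n a (labelled n v u) = \<one>\<^bsub>partition_monoid n\<^esub>"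
    unfolding a_eq labelled_inj_eq_one[OF u(1), symmetric]
    by (rule labelled_product_same_middle) (unfold uv, rule Int_lower1)
  moreover have "diagram_product n (labelled n v u) a = \<one>\<^bsub>partition_monoid n\<^esub>"
    unfolding a_eq labelled_inj_eq_one[OF v, symmetric]
    by (rule labelled_product_same_middle) (unfold uv, rule Int_lower1)
  ultimately show "a \<in> Units (partition_monoid n)"
    using a labelled_in_partitions[of n v u] unfolding Units_def
    by (auto simp: partition_monoid_def)
qed

text \<open>With \<open>n\<close> common labels, \<open>u\<close> would be injective and share all
  its labels with \<open>v\<close>, which makes the partition a unit.\<close>

lemma card_common_labels_singular:
  assumes "labelled n u v \<in> singular_partitions n"
  shows "card (u ` {1..n} \<inter> v ` {1..n}) < n"
proof (rule ccontr)
  assume large: "\<not> ?thesis"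
  have cu: "card (u ` {1..n}) \<le> n" using card_image_le[of "{1..n}" u] by simp
  have sub: "u ` {1..n} \<inter> v ` {1..n} = u ` {1..n}"
    using large cu by (intro card_seteq) auto
  then have "card (u ` {1..n}) = n" using large cu by simp
  then have "inj_on u {1..n}"
    by (intro eq_card_imp_inj_on) simp_all
  then have "joins_rows n (labelled n u v)"
    unfolding joins_rows_labelled using sub by blast
  then show False
    using assms Units_iff_joins_rows[OF labelled_in_partitions] unfolding singular_partitions_def by blast
qed

text \<open>This covers products whose left factor is the identity. Connections in the upper row of
  \<open>b\<close> are transported through the vertical edges of the identity, and paths preserve
  the labels of \<open>b\<close> carried up to the top row.\<close>

lemma joins_rows_one_mult:
  assumes b: "b \<in> partitions n" and Q: "joins_rows n (diagram_product n (\<one>\<^bsub>partition_monoid n\<^esub>) b)"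
  shows "joins_rows n b"
proof -
  obtain u v where b_eq: "b = labelled n u v" using b by (rule labelled_cases)
  let ?E = "product_graph (labelled n id id) (labelled n u v)"
  note edge = product_graph_labelledI[where n = n and u = id and g = id and k = u and v = v]
  have E: "label u u v x = label u u v y" if "(x, y) \<in> ?E" for x y
    using that
  proof (cases rule: product_graph_labelledE)
    case (1 x' y')
    then show ?thesis by (auto simp: outer_vertices_def)
  next
    case (2 x' y')
    then show ?thesis by (auto simp: outer_vertices_def)
  qed
  have path: "label u u v x = label u u v y" if "(x, y) \<in> ?E\<^sup>*" for x y
    using that by (induction rule: rtrancl_induct) (simp, metis E)
  have be: "block_edges (diagram_product n (\<one>\<^bsub>partition_monoid n\<^esub>) b) =
      {(x, y) \<in> outer_vertices n \<times> outer_vertices n. (x, y) \<in> ?E\<^sup>*}"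
    unfolding block_edges_product one_partition_monoid b_eq ..
  have "inj_on u {1..n}"
  proof (rule inj_onI)
    fix i j assume ij: "i \<in> {1..n}" "j \<in> {1..n}" "u i = u j"
    \<comment> \<open>Down through the identity, across the upper row of \<open>b\<close>, and up
      again.\<close>
    have "(Up i, Mid i) \<in> ?E" "(Mid i, Mid j) \<in> ?E" "(Mid j, Up j) \<in> ?E"
      using edge(2)[OF ij(1,1)] edge(4)[OF ij] edge(2)[OF ij(2,2)] symD[OF sym_product_graph] by simp_all
    then have "(Up i, Up j) \<in> ?E\<^sup>*"
      by (meson converse_rtrancl_into_rtrancl rtrancl.rtrancl_refl)
    then have "(Up i, Up j) \<in> block_edges (diagram_product n (\<one>\<^bsub>partition_monoid n\<^esub>) b)"
      unfolding be using ij by (simp add: outer_vertices_def)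
    then show "i = j"
      using Q ij unfolding joins_rows_def by blast
  qed
  moreover have "u i \<in> v ` {1..n}" if i: "i \<in> {1..n}" for i
  proof -
    obtain j where j: "j \<in> {1..n}" "(Up i, Low j) \<in> ?E\<^sup>*"
      using Q i unfolding joins_rows_def be by blast
    have "u i = v j" using path[OF j(2)] by simp
    then show ?thesis using j(1) by blast
  qed
  ultimately show ?thesis
    unfolding b_eq joins_rows_labelled by blast
qed

text \<open>Following transversals from \<open>i\<close> to \<open>j\<close> and then from
  \<open>j\<close> to \<open>k\<close> joins \<open>i\<close> to the lower \<open>k\<close> in the
  square. Idempotence puts them in one block of \<open>a\<close>, hence \<open>u i = u j\<close>,
  and injectivity gives \<open>i = j\<close>: every transversal is vertical.\<close>

lemma idempotent_joins_rows_eq_one: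
  assumes a: "a \<in> partitions n" and Q: "joins_rows n a" and idem: "diagram_product n a a = a"
  shows "a = \<one>\<^bsub>partition_monoid n\<^esub>"
proof -
  obtain u v where a_eq: "a = labelled n u v" using a by (rule labelled_cases)
  have u: "inj_on u {1..n}" "u ` {1..n} \<subseteq> v ` {1..n}"
    using Q unfolding a_eq joins_rows_labelled by auto
  note edge = product_graph_labelledI[where n = n and u = u and g = v and k = u and v = v]
  have "\<exists>j\<in>{1..n}. u i = v j \<and> j = i" if i: "i \<in> {1..n}" for i
  proof -
    obtain j where j: "j \<in> {1..n}" "u i = v j" using u(2) i by blast
    obtain k where k: "k \<in> {1..n}" "u j = v k" using u(2) j(1) by blast
    have "(Up i, Low k) \<in> (product_graph a a)\<^sup>*"
      unfolding a_eq using edge(2)[OF i j] edge(5)[OF j(1) k]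
      by (meson converse_rtrancl_into_rtrancl rtrancl.rtrancl_refl)
    then have "(Up i, Low k) \<in> block_edges (diagram_product n a a)"
      using i k(1) by (simp add: block_edges_product outer_vertices_def)
    then have "u i = v k"
      unfolding idem unfolding a_eq block_edges_labelled[of n u v u] by simp
    then have "u i = u j" using k(2) by simp
    then have "i = j" using u(1) i j(1) by (simp only: inj_on_eq_iff)
    then show ?thesis using j by blast
  qed
  then have vu: "v i = u i" if "i \<in> {1..n}" for i
    using that by metis
  have "labelled n u v = labelled n u u"
    unfolding labelled_def by (rule fibres_cong) (auto simp: outer_vertices_def vu)
  then show ?thesis
    using a_eq labelled_inj_eq_one[OF u(1)] by simp
qed

section \<open>Closure of the right-hand side and the two inclusions\<close>

lemma singular_partitions_eq: "singular_partitions n = {a \<in> partitions n. \<not> joins_rows n a}"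
  unfolding singular_partitions_def using Units_iff_joins_rows by (auto simp: partition_monoid_def)

lemma one_in_partitions: "\<one>\<^bsub>partition_monoid n\<^esub> \<in> partitions n"
  by (simp add: one_partition_monoid labelled_in_partitions)

lemma one_mult_one:
  "diagram_product n \<one>\<^bsub>partition_monoid n\<^esub> \<one>\<^bsub>partition_monoid n\<^esub> = \<one>\<^bsub>partition_monoid n\<^esub>"
  "canonical_twisting n \<one>\<^bsub>partition_monoid n\<^esub> \<one>\<^bsub>partition_monoid n\<^esub> = 0"
  unfolding one_partition_monoid by (simp_all add: labelled_product_same_middle)

text \<open>A singular left factor makes the product singular; the only other left factor is
  \<open>(0, 1)\<close>, which keeps singular right factors singular and squares to itself.\<close>

lemma submonoid_singular:
  "submonoid ({(0, \<one>\<^bsub>partition_monoid n\<^esub>)} \<union> (UNIV :: nat set) \<times> singular_partitions n)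
     (twisted_partition_monoid n)"
  (is "submonoid ?H _")
proof
  show "?H \<subseteq> carrier (twisted_partition_monoid n)"
    using one_in_partitions
    by (auto simp: twisted_product_def singular_partitions_def partition_monoid_def)
  show "\<one>\<^bsub>twisted_partition_monoid n\<^esub> \<in> ?H"
    by (simp add: twisted_product_def)
  fix x y assume "x \<in> ?H" "y \<in> ?H"
  moreover obtain i a j b where xy: "x = (i, a)" "y = (j, b)" by fastforce
  moreover have "diagram_product n a b \<in> singular_partitions n"
    if "a \<in> singular_partitions n" "b \<in> partitions n"
    using that joins_rows_left_factor diagram_product_in_partitions unfolding singular_partitions_eq by blast
  moreover have "diagram_product n \<one>\<^bsub>partition_monoid n\<^esub> b \<in> singular_partitions n"
    if "b \<in> singular_partitions n"
    using that joins_rows_one_mult diagram_product_in_partitions unfolding singular_partitions_eq by blast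
  moreover have "b \<in> partitions n" if "b \<in> singular_partitions n"
    using that unfolding singular_partitions_eq by blast
  moreover have "x \<otimes>\<^bsub>twisted_partition_monoid n\<^esub> y = (i + j + canonical_twisting n a b, diagram_product n a b)"
    by (simp add: xy twisted_product_def partition_monoid_def)
  ultimately show "x \<otimes>\<^bsub>twisted_partition_monoid n\<^esub> y \<in> ?H"
    using one_in_partitions[of n] one_mult_one[of n] by auto
qed

theorem theorem8p6:
  fixes n :: nat
  assumes "n \<ge> 2"
  shows "generated_submonoid (twisted_partition_monoid n) (idempotents (twisted_partition_monoid n)) =
           {(0, \<one>\<^bsub>partition_monoid n\<^esub>)} \<union> (UNIV :: nat set) \<times> singular_partitions n"
proof
  have "x \<in> {(0, \<one>\<^bsub>partition_monoid n\<^esub>)} \<union> (UNIV :: nat set) \<times> singular_partitions n"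
    if "x \<in> idempotents (twisted_partition_monoid n)" for x
  proof -
    obtain i a where x: "x = (i, a)" by fastforce
    have a: "a \<in> partitions n" "i + i + canonical_twisting n a a = i" "diagram_product n a a = a"
      using that unfolding x by (auto simp: idempotents_def twisted_product_def partition_monoid_def)
    \<comment> \<open>The equation for the first coordinate forces \<open>i = 0\<close>, so an
      idempotent whose partition is a unit must be \<open>(0, 1)\<close>. If the partition is not a
      unit, it is singular.\<close>
    then show ?thesis
      using idempotent_joins_rows_eq_one[OF a(1) _ a(3)] unfolding x singular_partitions_eq by auto
  qed
  then show "generated_submonoid (twisted_partition_monoid n) (idempotents (twisted_partition_monoid n))
      \<subseteq> {(0, \<one>\<^bsub>partition_monoid n\<^esub>)} \<union> (UNIV :: nat set) \<times> singular_partitions n"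
    unfolding generated_submonoid_def by (intro hull_minimal submonoid_singular subsetI)
  have "(0, \<one>\<^bsub>partition_monoid n\<^esub>) \<in> twisted_generated n"
    by (rule twisted_generated_idempotent[OF one_in_partitions one_mult_one])
  moreover have "(k, a) \<in> twisted_generated n" if a: "a \<in> singular_partitions n" for k a
  proof -
    obtain u v where "a = labelled n u v"
      using a labelled_cases unfolding singular_partitions_eq by blast
    then show ?thesis
      using twisted_generated_labelled[OF assms card_common_labels_singular] a by blast
  qed
  ultimately show "{(0, \<one>\<^bsub>partition_monoid n\<^esub>)} \<union> (UNIV :: nat set) \<times> singular_partitions n
      \<subseteq> generated_submonoid (twisted_partition_monoid n) (idempotents (twisted_partition_monoid n))"
    by auto
qed

end
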